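(* The function $Q(x)=e^{\psi(x+1)}-x$ is strictly decreasing and strictly convex on $(-1,\infty)$.
   Context: $\Gamma(x)=\int_0^\infty e^{-t}t^{x-1}\,dt$ for $x>0$ is Euler's gamma function, and $\psi(x)=\frac{d}{dx}\ln\Gamma(x)=\Gamma'(x)/\Gamma(x)$ for $x>0$ is the psi (digamma) function. Thus $\psi(x+1)$ is defined for all real $x>-1$. *)

theory Defs
  imports "HOL-Analysis.Analysis"
begin

(* The strict counterpart of convex_on, laid out in the same way. *)
definition strict_convex_on :: "'a::real_vector set \<Rightarrow> ('a \<Rightarrow> real) \<Rightarrow> bool" where
  "strict_convex_on S f \<longleftrightarrow> convex S \<and>
    (\<forall>x\<in>S. \<forall>y\<in>S. x \<noteq> y \<longrightarrow> (\<forall>u>0. \<forall>v>0. u + v = 1 \<longrightarrow>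
      f (u *\<^sub>R x + v *\<^sub>R y) < u * f x + v * f y))"

(* The library defines Digamma by a series. On the positive reals it is the
   logarithmic derivative of Gamma. *)
lemma deriv_ln_Gamma_eq_Digamma:
  fixes x :: real
  assumes "x > 0"
  shows "deriv (\<lambda>t. ln (Gamma t)) x = Digamma x"
    and "deriv Gamma x / Gamma x = Digamma x"
proof -
  have G: "Gamma x > 0" using assms by (rule Gamma_real_pos)
  have d: "(Gamma has_real_derivative Gamma x * Digamma x) (at x)"
    using assms by (intro has_field_derivative_Gamma) (auto elim!: nonpos_Ints_cases)
  have "((\<lambda>t. ln (Gamma t)) has_real_derivative 1 / Gamma x * (Gamma x * Digamma x)) (at x)"
    using G by (intro DERIV_chain2[OF _ d] DERIV_ln_divide)
  then show "deriv (\<lambda>t. ln (Gamma t)) x = Digamma x"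
    using G DERIV_imp_deriv by fastforce
  show "deriv Gamma x / Gamma x = Digamma x"
    using DERIV_imp_deriv[OF d] G by simp
qed

definition Q :: "real \<Rightarrow> real" where
  "Q x = exp (Digamma (x + 1)) - x"

end

theory Submission
  imports Defs "HOL-Real_Asymp.Real_Asymp"
begin

text \<open>
  Write \<open>\<psi>\<close> for the digamma function. Since \<open>(exp \<circ> \<psi>)'' = (\<psi>'' + (\<psi>')\<^sup>2) \<cdot> (exp \<circ> \<psi>)\<close>, strict
  convexity of \<open>Q\<close> amounts to \<open>(\<psi>')\<^sup>2 + \<psi>'' > 0\<close> on the positive reals. This is proved by
  telescoping (\<open>pos_if_unit_steps_decrease\<close>): a function that tends to \<open>0\<close> along \<open>x, x + 1, x + 2, \<dots>\<close>
  and drops at each unit step is positive. The unit steps are computable, because the functional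
  equation of \<open>\<psi>\<close> makes the difference \<open>\<psi>'(x) - \<psi>'(x + 1)\<close> equal to \<open>1/x\<^sup>2\<close> and
  \<open>\<psi>''(x) - \<psi>''(x + 1)\<close> equal to \<open>-2/x\<^sup>3\<close>. For \<open>(\<psi>')\<^sup>2 + \<psi>''\<close> the drop is
  \<open>2/x\<^sup>2 \<cdot> (\<psi>'(x) - 1/x - 1/(2x\<^sup>2))\<close>; for the factor in brackets it is \<open>(1/x - 1/(x + 1))\<^sup>2 / 2\<close>,
  a square. Two applications of the principle therefore suffice
  (\<open>Polygamma_1_lower_bound\<close>, \<open>Polygamma_1_square_plus_Polygamma_2_pos\<close>).

  Monotonicity follows from convexity together with an upper bound for \<open>Q\<close>. Log-convexity of \<open>\<Gamma>\<close> gives \<open>\<psi>(x) \<le> ln x\<close>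
  (\<open>Digamma_le_ln\<close>), so \<open>Q \<le> 1\<close>, and a strictly convex function that is bounded above on a ray
  to \<open>\<infinity>\<close> is strictly decreasing there (\<open>strict_antimono_on_if_strict_convex_bounded\<close>).
\<close>

section \<open>Strict convexity on the real line\<close>

text \<open>
  The graph lies strictly above each of its tangents. Averaging this for the tangent at
  \<open>c = u x + v y\<close> over the two end points \<open>x\<close> and \<open>y\<close> cancels the linear terms.
\<close>

lemma strict_convex_on_if_deriv_strict_mono:
  fixes f f' :: "real \<Rightarrow> real"
  assumes S: "convex S"
    and deriv: "\<And>x. x \<in> S \<Longrightarrow> (f has_real_derivative f' x) (at x)"
    and mono: "strict_mono_on S f'"
  shows "strict_convex_on S f"
proof -
  have tangent: "f c + f' c * (z - c) < f z" if c: "c \<in> S" and z: "z \<in> S" and "z \<noteq> c" for c z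
  proof (cases "c < z")
    case True
    have sub: "{c..z} \<subseteq> S"
      using S c z by (meson atLeastAtMost_iff is_interval_1 is_interval_convex_1 subsetI)
    obtain t where t: "c < t" "t < z" "f z - f c = (z - c) * f' t"
      using MVT2[OF True, of f f'] deriv sub by (auto simp: subset_iff)
    have "f' c < f' t" using c sub t by (auto intro!: strict_mono_onD[OF mono])
    then have "(z - c) * f' c < (z - c) * f' t" using True by simp
    then show ?thesis using t by (simp add: algebra_simps)
  next
    case False
    then have less: "z < c" using \<open>z \<noteq> c\<close> by simp
    have sub: "{z..c} \<subseteq> S"
      using S c z by (meson atLeastAtMost_iff is_interval_1 is_interval_convex_1 subsetI)
    obtain t where t: "z < t" "t < c" "f c - f z = (c - z) * f' t"
      using MVT2[OF less, of f f'] deriv sub by (auto simp: subset_iff)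
    have "f' t < f' c" using c sub t by (auto intro!: strict_mono_onD[OF mono])
    then have "(c - z) * f' t < (c - z) * f' c" using less by simp
    then show ?thesis using t by (simp add: algebra_simps)
  qed
  have "f (u *\<^sub>R x + v *\<^sub>R y) < u * f x + v * f y"
    if x: "x \<in> S" and y: "y \<in> S" and ne: "x \<noteq> y" and uv: "u > 0" "v > 0" "u + v = 1" for x y u v
  proof -
    define c where "c = u * x + v * y"
    have c: "c \<in> S" using convexD[OF S x y, of u v] uv by (simp add: c_def)
    have u: "u = 1 - v" using uv by simp
    have xc: "x - c = v * (x - y)" and yc: "y - c = u * (y - x)"
      unfolding c_def u by (simp_all add: algebra_simps)
    then have "x \<noteq> c" "y \<noteq> c" using ne uv by auto
    then have "u * (f c + f' c * (x - c)) < u * f x" "v * (f c + f' c * (y - c)) < v * f y"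
      using tangent[OF c] x y uv by simp_all
    then have "u * (f c + f' c * (x - c)) + v * (f c + f' c * (y - c)) < u * f x + v * f y"
      by simp
    also have "u * (f c + f' c * (x - c)) + v * (f c + f' c * (y - c)) = f c"
      unfolding xc yc u by (simp add: algebra_simps)
    finally show ?thesis by (simp add: c_def)
  qed
  then show ?thesis using S by (simp add: strict_convex_on_def)
qed

text \<open>
  If \<open>f x \<le> f y\<close> for some \<open>x < y\<close>, then \<open>f\<close> grows strictly from \<open>y\<close> to \<open>z = 2 y - x\<close>, and convexity
  keeps \<open>f\<close> above the rising line through the points over \<open>y\<close> and \<open>z\<close>, so \<open>f\<close> would be unbounded.
\<close>

lemma strict_antimono_on_if_strict_convex_bounded:
  fixes f :: "real \<Rightarrow> real"
  assumes conv: "strict_convex_on {a<..} f"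
    and bound: "\<And>x. x > a \<Longrightarrow> f x \<le> B"
  shows "strict_antimono_on {a<..} f"
proof (rule monotone_onI)
  fix x y :: real
  assume x: "x \<in> {a<..}" and y: "y \<in> {a<..}" and "x < y"
  show "f x > f y"
  proof (rule ccontr)
    assume "\<not> f x > f y"
    define z where "z = 2 * y - x"
    have convD: "f (u * p + v * q) < u * f p + v * f q"
      if "a < p" "p < q" "u > 0" "v > 0" "u + v = 1" for p q u v
      using conv that by (simp add: strict_convex_on_def)
    have "f (1/2 * x + 1/2 * z) < 1/2 * f x + 1/2 * f z"
      using x \<open>x < y\<close> by (intro convD) (auto simp: z_def)
    moreover have "1/2 * x + 1/2 * z = y" by (simp add: z_def field_simps)
    ultimately have "f y < f z" using \<open>\<not> f x > f y\<close> by simp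
    define d where "d = f z - f y"
    have "d > 0" using \<open>f y < f z\<close> by (simp add: d_def)
    \<comment> \<open>at \<open>t\<close> times the distance from \<open>y\<close> to \<open>z\<close>, the line has risen to \<open>f y + t * d > B\<close>\<close>
    define t where "t = \<bar>B - f y\<bar> / d + 2"
    have t: "t > 1" using \<open>d > 0\<close> by (simp add: t_def add_pos_nonneg)
    define w where "w = y + t * (z - y)"
    have "y < w" using t \<open>x < y\<close> by (simp add: w_def z_def)
    have "f ((1 - 1/t) * y + 1/t * w) < (1 - 1/t) * f y + 1/t * f w"
      using t y \<open>y < w\<close> by (intro convD) auto
    moreover have "(1 - 1/t) * y + 1/t * w = z"
      using t by (simp add: w_def field_simps)
    ultimately have "t * f z < t * ((1 - 1/t) * f y + 1/t * f w)"
      using t by simp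
    also have "\<dots> = (t - 1) * f y + f w"
      using t by (simp add: field_simps)
    finally have "f y + t * d < f w" by (simp add: d_def algebra_simps)
    moreover have "t * d = \<bar>B - f y\<bar> + 2 * d"
      using \<open>d > 0\<close> by (simp add: t_def field_simps)
    ultimately have "B < f w" using \<open>d > 0\<close> by linarith
    then show False using bound[of w] y \<open>y < w\<close> by simp
  qed
qed


section \<open>Inequalities for polygamma functions\<close>

text \<open>
  Along \<open>x + 1, x + 2, \<dots>\<close> the values of \<open>f\<close> decrease to \<open>0\<close>, so \<open>f (x + 1) \<ge> 0\<close>; the step from \<open>x\<close>
  to \<open>x + 1\<close> makes the inequality for \<open>f x\<close> strict.
\<close>

lemma pos_if_unit_steps_decrease:
  fixes f :: "real \<Rightarrow> real"
  assumes step: "\<And>x. x > 0 \<Longrightarrow> f (x + 1) < f x"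
    and lim: "\<And>x. x > 0 \<Longrightarrow> (\<lambda>m. f (x + real m)) \<longlonglongrightarrow> 0"
    and x: "x > 0"
  shows "f x > 0"
proof -
  have "decseq (\<lambda>m. f (x + 1 + real m))"
    unfolding decseq_Suc_iff
  proof
    fix m
    show "f (x + 1 + real (Suc m)) \<le> f (x + 1 + real m)"
      using step[of "x + 1 + real m"] x by (simp add: algebra_simps)
  qed
  then have "f (x + 1 + real 0) \<ge> 0"
    using lim[of "x + 1"] x by (intro decseq_ge) auto
  then show ?thesis using step[OF x] by simp
qed

text \<open>
  For \<open>n > 0\<close> the value at \<open>z + m\<close> is, up to a constant factor, a tail of the convergent series
  for the value at \<open>z\<close>.
\<close>

lemma Polygamma_shift_tendsto_0:
  fixes z :: real
  assumes z: "z > 0" and n: "n > 0"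
  shows "(\<lambda>m. Polygamma n (z + real m)) \<longlonglongrightarrow> 0"
proof -
  define s where "s = (\<Sum>k. inverse ((z + real k) ^ Suc n))"
  have "summable (\<lambda>k. inverse ((z + real k) ^ Suc n))"
    using z n by (intro Polygamma_converges') auto
  then have "(\<lambda>m. \<Sum>k<m. inverse ((z + real k) ^ Suc n)) \<longlonglongrightarrow> s"
    unfolding s_def by (rule summable_LIMSEQ)
  then have "(\<lambda>m. Polygamma n z + (-1) ^ n * fact n * (\<Sum>k<m. inverse ((z + real k) ^ Suc n)))
      \<longlonglongrightarrow> Polygamma n z + (-1) ^ n * fact n * s"
    by (intro tendsto_intros)
  moreover have "Polygamma n z + (-1) ^ n * fact n * s = 0"
    using n by (simp add: Polygamma_def s_def)
  moreover have "Polygamma n (z + real m) =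
      Polygamma n z + (-1) ^ n * fact n * (\<Sum>k<m. inverse ((z + real k) ^ Suc n))" for m
    using z by (subst Polygamma_plus_of_nat) (auto simp: inverse_eq_divide)
  ultimately show ?thesis by simp
qed

lemma Polygamma_1_plus1: "Polygamma 1 (x + 1) = Polygamma 1 x - 1 / x\<^sup>2" if "x > 0" for x :: real
  using that Polygamma_plus1[of x 1] by (simp add: power2_eq_square)

lemma Polygamma_2_plus1: "Polygamma 2 (x + 1) = Polygamma 2 x + 2 / x ^ 3" if "x > 0" for x :: real
  using that Polygamma_plus1[of x 2] by (simp add: numeral_eq_Suc)

lemma inverse_shift_tendsto_0: "(\<lambda>m. 1 / (x + real m)) \<longlonglongrightarrow> 0" for x :: real
  by real_asymp

lemma Polygamma_1_lower_bound:
  fixes x :: real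
  assumes "x > 0"
  shows "1 / x + 1 / (2 * x\<^sup>2) < Polygamma 1 x"
proof -
  define g :: "real \<Rightarrow> real" where "g = (\<lambda>x. Polygamma 1 x - 1 / x - 1 / (2 * x\<^sup>2))"
  have "g x > 0"
  proof (rule pos_if_unit_steps_decrease[OF _ _ assms])
    fix x :: real
    assume x: "x > 0"
    have "g x - g (x + 1) = (1 / x - 1 / (x + 1))\<^sup>2 / 2"
      using x unfolding g_def Polygamma_1_plus1[OF x]
      by (simp add: divide_simps) (simp add: algebra_simps power2_eq_square)
    moreover have "1 / x - 1 / (x + 1) > 0" using x by (simp add: frac_less2)
    ultimately have "g x - g (x + 1) > 0" by (metis half_gt_zero zero_less_power)
    then show "g (x + 1) < g x" by simp
    have "(\<lambda>m. Polygamma 1 (x + real m) - 1 / (x + real m) - 1 / 2 * (1 / (x + real m))\<^sup>2)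
        \<longlonglongrightarrow> 0 - 0 - 1 / 2 * 0\<^sup>2"
      using x by (intro tendsto_intros Polygamma_shift_tendsto_0 inverse_shift_tendsto_0) auto
    then show "(\<lambda>m. g (x + real m)) \<longlonglongrightarrow> 0"
      by (simp add: g_def power_divide)
  qed
  then show ?thesis by (simp add: g_def)
qed

lemma Polygamma_1_square_plus_Polygamma_2_pos:
  fixes x :: real
  assumes "x > 0"
  shows "(Polygamma 1 x)\<^sup>2 + Polygamma 2 x > 0"
proof (rule pos_if_unit_steps_decrease[OF _ _ assms])
  fix x :: real
  assume x: "x > 0"
  have "((Polygamma 1 x)\<^sup>2 + Polygamma 2 x) - ((Polygamma 1 (x + 1))\<^sup>2 + Polygamma 2 (x + 1))
      = 2 / x\<^sup>2 * (Polygamma 1 x - (1 / x + 1 / (2 * x\<^sup>2)))"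
    unfolding Polygamma_1_plus1[OF x] Polygamma_2_plus1[OF x]
    by (simp add: algebra_simps power2_eq_square power3_eq_cube)
  also have "\<dots> > 0" using Polygamma_1_lower_bound[OF x] x by simp
  finally show "(Polygamma 1 (x + 1))\<^sup>2 + Polygamma 2 (x + 1) < (Polygamma 1 x)\<^sup>2 + Polygamma 2 x"
    by simp
  have "(\<lambda>m. (Polygamma 1 (x + real m))\<^sup>2 + Polygamma 2 (x + real m)) \<longlonglongrightarrow> 0\<^sup>2 + 0"
    using x by (intro tendsto_intros Polygamma_shift_tendsto_0) auto
  then show "(\<lambda>m. (Polygamma 1 (x + real m))\<^sup>2 + Polygamma 2 (x + real m)) \<longlonglongrightarrow> 0"
    by simp
qed

text \<open>
  The mean slope of \<open>ln \<circ> \<Gamma>\<close> on \<open>[x, x + 1]\<close> is \<open>ln x\<close>, by the functional equation, and its slope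
  \<open>\<psi>\<close> increases.
\<close>

lemma Digamma_le_ln:
  fixes x :: real
  assumes x: "x > 0"
  shows "Digamma x \<le> ln x"
proof -
  obtain t where t: "x < t" "t < x + 1"
    "ln_Gamma (x + 1) - ln_Gamma x = (x + 1 - x) * Digamma t"
    using MVT2[of x "x + 1" ln_Gamma Digamma] x has_field_derivative_ln_Gamma_real
    by force
  have "ln_Gamma (x + 1) = ln (x * Gamma x)"
    using x Gamma_plus1[of x] by (simp add: ln_Gamma_real_pos nonpos_Ints_def)
  also have "\<dots> = ln x + ln_Gamma x"
    using x Gamma_real_pos[OF x, THEN less_imp_neq] by (simp add: ln_Gamma_real_pos ln_mult)
  finally have "Digamma t = ln x" using t by simp
  then show ?thesis using Digamma_real_mono[of x t] x t by simp
qed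


section \<open>The function \<open>Q\<close>\<close>

lemma Q_le_1:
  assumes "x > -1"
  shows "Q x \<le> 1"
proof -
  have "exp (Digamma (x + 1)) \<le> x + 1"
    using Digamma_le_ln[of "x + 1"] assms ln_ge_iff[of "x + 1" "Digamma (x + 1)"] by simp
  then show ?thesis by (simp add: Q_def)
qed

lemma strict_convex_on_Q: "strict_convex_on {-1<..} Q"
proof -
  define Q' where "Q' = (\<lambda>x::real. Polygamma 1 (x + 1) * exp (Digamma (x + 1)) - 1)"
  define Q'' where "Q'' =
    (\<lambda>x::real. ((Polygamma 1 (x + 1))\<^sup>2 + Polygamma 2 (x + 1)) * exp (Digamma (x + 1)))"
  have deriv_Polygamma_shift:
    "((\<lambda>x. Polygamma n (x + 1)) has_real_derivative Polygamma (Suc n) (x + 1)) (at x)"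
    if "x > -1" for n x
    using that by (auto intro!: derivative_eq_intros elim!: nonpos_Ints_cases)
  have Q': "(Q has_real_derivative Q' x) (at x)" if "x > -1" for x
    unfolding Q_def[abs_def] Q'_def
    using that by (auto intro!: derivative_eq_intros deriv_Polygamma_shift)
  have Q'': "(Q' has_real_derivative Q'' x) (at x)" if "x > -1" for x
    unfolding Q'_def Q''_def
    using that by (auto intro!: derivative_eq_intros deriv_Polygamma_shift
      simp: algebra_simps power2_eq_square numeral_2_eq_2)
  have pos: "Q'' x > 0" if "x > -1" for x
    using Polygamma_1_square_plus_Polygamma_2_pos[of "x + 1"] that by (simp add: Q''_def)
  have "strict_mono_on {-1<..} Q'"
  proof (rule strict_mono_onI)
    fix x y :: real
    assume x: "x \<in> {-1<..}" and "x < y"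
    show "Q' x < Q' y"
    proof (rule DERIV_pos_imp_increasing[OF \<open>x < y\<close>])
      fix t
      assume "x \<le> t" "t \<le> y"
      then have "t > -1" using x by simp
      then show "\<exists>d. (Q' has_real_derivative d) (at t) \<and> d > 0" using Q'' pos by blast
    qed
  qed
  then show ?thesis
    by (intro strict_convex_on_if_deriv_strict_mono[of _ _ Q']) (auto intro: Q')
qed

theorem theorem2:
  shows "strict_antimono_on {-1<..} Q \<and> strict_convex_on {-1<..} Q"
  using strict_antimono_on_if_strict_convex_bounded[OF strict_convex_on_Q Q_le_1]
    strict_convex_on_Q by simp

end
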